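(* Let $k$ be a positive integer. If $A \in \mathcal{M}_n^{+}$ has bandwidth at most $k$, then $\mathrm{fran}_k(A) = \mathrm{rank}(A)$.
   Context: Let $\mathbb{F} \in \{\mathbb{R},\mathbb{C}\}$ (the result holds for either field). $\mathcal{M}_n^{+}$ denotes the set of $n \times n$ positive semidefinite (real symmetric if $\mathbb{F}=\mathbb{R}$, Hermitian if $\mathbb{F}=\mathbb{C}$) matrices over $\mathbb{F}$. The bandwidth of $A$ is the smallest positive integer $k$ such that $a_{i,j}=0$ whenever $|i-j| \geq k$. $A$ has factor width at most $k$ if $A = \sum_{j=1}^r \mathbf{v}_j\mathbf{v}_j^*$ for some $\mathbf{v}_1,\ldots,\mathbf{v}_r \in \mathbb{F}^n$, each with at most $k$ non-zero entries; the factor-width-$k$ rank $\mathrm{fran}_k(A)$ is the least integer $r$ for which such a decomposition exists (the zero matrix being an empty sum, $r=0$). Part of the claim is that such a decomposition exists. *)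

theory Defs
  imports "Jordan_Normal_Form.DL_Rank" "Jordan_Normal_Form.Schur_Decomposition"
begin

(* Everything is stated over a conjugatable ordered field, so that one definition serves both
   real matrices (conjugation is the identity) and complex ones (conjugation is cnj). On the
   complex numbers "0 \<le> z" means that z is real and nonnegative. *)

(* The scalar (A *\<^sub>v x) \<bullet>c x is the quadratic form x^* A x. *)
definition psd_mats :: "nat \<Rightarrow> 'a :: conjugatable_ordered_field mat set" where
  "psd_mats n = {A \<in> carrier_mat n n. mat_adjoint A = A \<and>
     (\<forall>x \<in> carrier_vec n. 0 \<le> (A *\<^sub>v x) \<bullet>c x)}"

definition bandwidth :: "'a :: zero mat \<Rightarrow> nat" where
  "bandwidth A = (LEAST b. 0 < b \<and>
     (\<forall>i < dim_row A. \<forall>j < dim_col A. int b \<le> \<bar>int i - int j\<bar> \<longrightarrow> A $$ (i, j) = 0))"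

definition outer_self :: "'a :: conjugatable_field vec \<Rightarrow> 'a mat" where
  "outer_self v = mat (dim_vec v) (dim_vec v) (\<lambda>(i, j). v $ i * conjugate (v $ j))"

definition factor_decomp :: "nat \<Rightarrow> 'a :: conjugatable_field mat \<Rightarrow> 'a vec list \<Rightarrow> bool" where
  "factor_decomp k A vs \<longleftrightarrow>
     (\<forall>v \<in> set vs. v \<in> carrier_vec (dim_row A) \<and> card {i. i < dim_vec v \<and> v $ i \<noteq> 0} \<le> k) \<and>
     A = foldr (+) (map outer_self vs) (0\<^sub>m (dim_row A) (dim_row A))"

definition factor_width_at_most :: "nat \<Rightarrow> 'a :: conjugatable_field mat \<Rightarrow> bool" where
  "factor_width_at_most k A \<longleftrightarrow> (\<exists>vs. factor_decomp k A vs)"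

(* Only meaningful when factor_width_at_most k A holds; otherwise the LEAST ranges over nothing. *)
definition fran :: "nat \<Rightarrow> 'a :: conjugatable_field mat \<Rightarrow> nat" where
  "fran k A = (LEAST r. \<exists>vs. length vs = r \<and> factor_decomp k A vs)"

end

theory Submission
  imports Defs
begin

text \<open>
  The decomposition comes from Cholesky elimination in the natural order of the rows, without
  exchanging pivots. For a pivot \<open>a = A $$ (j, j) \<noteq> 0\<close>, take \<open>v\<close> to be column \<open>j\<close> of \<open>A\<close> divided by
  a square root of \<open>a\<close>. Then \<open>A - v v\<^sup>*\<close> is positive semidefinite again
  (\<open>psd_subtract_pivot\<close>), its row and column \<open>j\<close> vanish, and its rank is smaller than that of \<open>A\<close>
  (\<open>rank_subtract_pivot\<close>). If \<open>a = 0\<close>, positivity forces row and column \<open>j\<close> to vanish already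
  (\<open>psd_zero_diagonal_imp_zero_row\<close>), and the step is skipped.

  The band survives because of the order. When column \<open>j\<close> is treated, all earlier rows
  are zero, so \<open>v\<close> is supported on the \<open>k\<close> consecutive indices \<open>j, \<dots>, j + k - 1\<close>. Hence \<open>v\<close> has at most
  \<open>k\<close> non-zero entries, and \<open>v v\<^sup>*\<close> vanishes outside the band, as does the remainder. Since
  every vector produced lowers the rank, at most \<open>rank A\<close> of them occur
  (\<open>banded_psd_factor_decomp\<close>). Conversely, a sum of \<open>r\<close> matrices \<open>v v\<^sup>*\<close> has rank at most \<open>r\<close>
  (\<open>rank_sum_outer_self_le_length\<close>), so no decomposition is shorter.

  The only property of the field that is used beyond those of a conjugatable ordered field is
  that every \<open>a \<ge> 0\<close> has the form \<open>s * conjugate s\<close>. With this as a hypothesis (\<open>sqrts\<close>) the argument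
  covers the real and the complex case at once.
\<close>

section \<open>Rank and column spaces\<close>

text \<open>
  A maximal independent set of columns of \<open>B\<close> stays independent when a vector outside the range
  of \<open>B\<close> is added, and the enlarged set still lies in the column space of \<open>A\<close>.
\<close>
lemma (in vec_space) rank_less_if_range_psubset:
  assumes A: "A \<in> carrier_mat n nc" and B: "B \<in> carrier_mat n nc"
    and sub: "\<And>x. x \<in> carrier_vec nc \<Longrightarrow> \<exists>y \<in> carrier_vec nc. B *\<^sub>v x = A *\<^sub>v y"
    and x0: "x0 \<in> carrier_vec nc"
    and out: "\<And>x. x \<in> carrier_vec nc \<Longrightarrow> A *\<^sub>v x0 \<noteq> B *\<^sub>v x"
  shows "rank B < rank A"
proof -
  let ?v = "A *\<^sub>v x0"
  have v: "?v \<in> carrier_vec n" using A x0 by simp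
  have colA: "set (cols A) \<subseteq> carrier_vec n" and colB: "set (cols B) \<subseteq> carrier_vec n"
    using A B cols_dim by blast+
  have spanA: "span (set (cols A)) = {y \<in> carrier_vec n. \<exists>x\<in>carrier_vec nc. A *\<^sub>v x = y}"
    using col_space_eq[OF A] A by (simp add: col_space_def)
  have spanB: "span (set (cols B)) = {y \<in> carrier_vec n. \<exists>x\<in>carrier_vec nc. B *\<^sub>v x = y}"
    using col_space_eq[OF B] B by (simp add: col_space_def)
  have BA: "span (set (cols B)) \<subseteq> span (set (cols A))"
    unfolding spanA spanB using sub by fastforce
  have vA: "?v \<in> span (set (cols A))" unfolding spanA using v x0 by auto
  have vB: "?v \<notin> span (set (cols B))" unfolding spanB using out by fastforce
  have indpt_empty: "lin_indpt {}"
    by (meson fin_dim finite_basis_exists subset_li_is_li empty_subsetI vectorspace.basis_def vec_vs)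
  obtain S where S: "maximal S (\<lambda>T. T \<subseteq> set (cols B) \<and> lin_indpt T)"
    using maximal_exists_superset[of "set (cols B)" "\<lambda>T. T \<subseteq> set (cols B) \<and> lin_indpt T" "{}"]
      indpt_empty by auto
  have Sc: "S \<subseteq> set (cols B)" and Sl: "lin_indpt S" using S by (auto simp: maximal_def)
  have rB: "rank B = card S" by (rule rank_card_indpt[OF B S])
  have Sn: "S \<subseteq> carrier_vec n" using Sc colB by blast
  have Sspan: "span S \<subseteq> span (set (cols B))" by (rule span_is_monotone[OF Sc])
  have SB: "S \<subseteq> span (set (cols B))" using Sc colB span_mem by blast
  have vS: "?v \<notin> S" using vB SB by blast
  have ind: "lin_indpt (S \<union> {?v})"
    using lin_dep_iff_in_span[of S ?v] Sn Sl v vS vB Sspan by auto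
  have sm: "submodule class_ring (span (set (cols A))) V" using span_is_submodule colA by simp
  have subs: "S \<union> {?v} \<subseteq> span (set (cols A))" using SB BA vA by blast
  have vs: "vectorspace class_ring (span_vs (set (cols A)))"
    using span_is_subspace[THEN subspace_is_vs] colA by simp
  have "module.lin_dep class_ring (span_vs (set (cols A))) (S \<union> {?v}) = lin_dep (S \<union> {?v})"
    by (rule span_li_not_depend(2)[OF subs sm])
  then have "card (S \<union> {?v}) \<le> vectorspace.dim class_ring (span_vs (set (cols A)))"
    using vectorspace.li_le_dim(2)[OF vs fin_dim_span_cols[OF A], of "S \<union> {?v}"] subs ind by simp
  moreover have "finite S" using Sc finite_subset by blast
  ultimately have "Suc (card S) \<le> rank A" unfolding rank_def using vS by simp
  then show ?thesis unfolding rB by simp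
qed

lemma outer_self_carrier: "v \<in> carrier_vec n \<Longrightarrow> outer_self v \<in> carrier_mat n n"
  by (simp add: outer_self_def)

lemma rank_outer_self_le_1:
  assumes "v \<in> carrier_vec n"
  shows "vec_space.rank n (outer_self v) \<le> 1"
  by (rule vec_space.rank_le_1_product_entries[where f = "\<lambda>i. v $ i" and g = "\<lambda>j. conjugate (v $ j)"])
    (use assms in \<open>auto simp: outer_self_def\<close>)

lemma rank_sum_outer_self_le_length:
  fixes vs :: "'a :: conjugatable_field vec list"
  assumes "set vs \<subseteq> carrier_vec n"
  shows "foldr (+) (map outer_self vs) (0\<^sub>m n n) \<in> carrier_mat n n \<and>
    vec_space.rank n (foldr (+) (map outer_self vs) (0\<^sub>m n n)) \<le> length vs"
  using assms
proof (induction vs)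
  case Nil
  show ?case using vec_space.rank_0I[where n = n and nc = n and 'a = 'a] by simp
next
  case (Cons v vs)
  let ?S = "foldr (+) (map outer_self vs) (0\<^sub>m n n)"
  have v: "v \<in> carrier_vec n" and S: "?S \<in> carrier_mat n n"
    and r: "vec_space.rank n ?S \<le> length vs" using Cons by auto
  have "vec_space.rank n (outer_self v + ?S) \<le> vec_space.rank n (outer_self v) + vec_space.rank n ?S"
    by (rule vec_space.rank_subadditive[OF outer_self_carrier[OF v] S])
  then show ?case using r rank_outer_self_le_1[OF v] outer_self_carrier[OF v] S by simp
qed

section \<open>Positive semidefinite matrices\<close>

lemma conjugate_1 [simp]: "conjugate (1 :: 'a :: conjugatable_field) = 1"
proof -
  have "conjugate (1::'a) * conjugate 1 = conjugate 1 * 1"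
    by (simp flip: conjugate_dist_mul)
  moreover have "conjugate (1::'a) \<noteq> 0" by simp
  ultimately show ?thesis by (metis mult_left_cancel)
qed

lemma conjugate_divide:
  "conjugate (x / y) = conjugate x / conjugate (y :: 'a :: conjugatable_field)"
proof (cases "y = 0")
  case False
  then have "conjugate (x / y) * conjugate y = conjugate x"
    by (simp flip: conjugate_dist_mul)
  then show ?thesis using False by (simp add: field_simps)
qed simp

lemma conjugate_unit_vec [simp]:
  "conjugate (unit_vec n j) = (unit_vec n j :: 'a :: conjugatable_field vec)"
  by (rule eq_vecI) (auto simp: unit_vec_def)

lemma cscalar_prod_add_unit:
  fixes w :: "'a :: conjugatable_field vec"
  assumes w: "w \<in> carrier_vec n" and x: "x \<in> carrier_vec n" and j: "j < n"
  shows "w \<bullet>c (x + q \<cdot>\<^sub>v unit_vec n j) = w \<bullet>c x + conjugate q * w $ j"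
proof -
  have "conjugate (x + q \<cdot>\<^sub>v unit_vec n j) = conjugate x + conjugate q \<cdot>\<^sub>v unit_vec n j"
    using x by (subst conjugate_add_vec[of _ n]) (auto simp: conjugate_smult_vec)
  then show ?thesis using w x j by (simp add: scalar_prod_add_distrib[of _ n])
qed

lemma mult_mat_vec_unit:
  fixes A :: "'a :: field mat"
  assumes "A \<in> carrier_mat n n" "j < n"
  shows "A *\<^sub>v unit_vec n j = col A j"
  using assms by (intro eq_vecI) auto

lemma mat_adjoint_index:
  assumes "A \<in> carrier_mat n n" "i < n" "j < n"
  shows "mat_adjoint A $$ (i, j) = conjugate (A $$ (j, i))"
  using assms unfolding mat_adjoint_def by (simp add: mat_of_rows_index)

lemma psd_hermitian:
  assumes A: "A \<in> psd_mats n" and i: "i < n" and j: "j < n"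
  shows "A $$ (j, i) = conjugate (A $$ (i, j))"
proof -
  have c: "A \<in> carrier_mat n n" and h: "mat_adjoint A = A" using A by (auto simp: psd_mats_def)
  show ?thesis using mat_adjoint_index[OF c j i] h by simp
qed

text \<open>The diagonal entry is the quadratic form at a unit vector.\<close>
lemma psd_diagonal_nonneg:
  fixes A :: "'a :: conjugatable_ordered_field mat"
  assumes A: "A \<in> psd_mats n" and i: "i < n"
  shows "0 \<le> A $$ (i, i)"
proof -
  have c: "A \<in> carrier_mat n n" using A by (simp add: psd_mats_def)
  have "(A *\<^sub>v unit_vec n i) \<bullet>c unit_vec n i = A $$ (i, i)"
    unfolding mult_mat_vec_unit[OF c i] using c i by simp
  then show ?thesis using A unit_vec_carrier[of n i] unfolding psd_mats_def by fastforce
qed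

text \<open>
  If \<open>A $$ (j, j) = 0\<close>, the quadratic form at \<open>e\<^sub>i + q e\<^sub>j\<close> is \<open>A $$ (i, i)\<close> plus terms linear
  in \<open>q\<close> and \<open>conjugate q\<close> with coefficients \<open>A $$ (i, j)\<close> and \<open>A $$ (j, i)\<close>. Were these
  coefficients non-zero, a suitable \<open>q\<close> would make the form negative.
\<close>
lemma psd_zero_diagonal_imp_zero_row:
  fixes A :: "'a :: conjugatable_ordered_field mat"
  assumes A: "A \<in> psd_mats n" and i: "i < n" and j: "j < n" and d: "A $$ (j, j) = 0"
  shows "A $$ (j, i) = 0"
proof (rule ccontr)
  let ?b = "A $$ (j, i)" and ?f = "A $$ (i, i)"
  assume b: "?b \<noteq> 0"
  \<comment> \<open>Each of the two linear terms then equals \<open>- (?f + 1)\<close>, so the form has the value \<open>- (?f + 2)\<close>.\<close>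
  define q where "q = conjugate (- (?f + 1) / ?b)"
  define x where "x = unit_vec n i + q \<cdot>\<^sub>v unit_vec n j"
  have c: "A \<in> carrier_mat n n" using A by (simp add: psd_mats_def)
  have x: "x \<in> carrier_vec n" by (simp add: x_def)
  have Ax: "A *\<^sub>v x = col A i + q \<cdot>\<^sub>v col A j"
    unfolding x_def using c i j
    by (subst mult_add_distrib_mat_vec[OF c]) (auto simp: mult_mat_vec[OF c] mult_mat_vec_unit)
  have Axc: "A *\<^sub>v x \<in> carrier_vec n" using c x by simp
  have "(A *\<^sub>v x) \<bullet>c unit_vec n i = (A *\<^sub>v x) $ i"
    using i by simp
  then have "(A *\<^sub>v x) \<bullet>c x = (A *\<^sub>v x) $ i + conjugate q * (A *\<^sub>v x) $ j"
    by (subst (2) x_def, subst cscalar_prod_add_unit[OF Axc _ j]) auto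
  also have "\<dots> = ?f + q * A $$ (i, j) + conjugate q * ?b"
    using c i j d by (simp add: Ax)
  also have "q * A $$ (i, j) = conjugate (conjugate q * ?b)"
    using psd_hermitian[OF A j i] by (simp add: conjugate_dist_mul)
  also have q: "conjugate q * ?b = - (?f + 1)" using b by (simp add: q_def)
  also have "conjugate (- (?f + 1)) = - (?f + 1)"
    using psd_hermitian[OF A i i] by (simp only: conjugate_neg conjugate_dist_add conjugate_1)
  finally have "(A *\<^sub>v x) \<bullet>c x = - (?f + 1 + 1)" by simp
  then have neg: "0 \<le> - (?f + 1 + 1)" using A x by (auto simp: psd_mats_def)
  \<comment> \<open>The order need not be compatible with multiplication, so the contradiction
    \<open>0 \<le> - 1\<close> is reached by adding the nonnegative \<open>?f + 1\<close>.\<close>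
  have one: "0 \<le> (1 :: 'a)" using conjugate_square_positive[of "1::'a"] by simp
  have f: "0 \<le> ?f + 1" using add_mono[OF psd_diagonal_nonneg[OF A i] one] by simp
  have "(?f + 1) + 0 \<le> (?f + 1) + - (?f + 1 + 1)" using neg by (rule add_left_mono)
  then have "0 \<le> (?f + 1) + - (?f + 1 + 1)" by (metis f add.right_neutral order_trans)
  then have "1 + 0 \<le> 1 + (- 1 :: 'a)" by (intro add_left_mono) simp
  then show False using one by (simp add: order_antisym)
qed

section \<open>One elimination step\<close>

text \<open>
  Column \<open>j\<close> of \<open>A\<close> divided by \<open>conjugate s\<close>, where \<open>s * conjugate s\<close> is to be the pivot
  \<open>A $$ (j, j)\<close>.
\<close>
definition pivot_vec :: "'a :: conjugatable_field mat \<Rightarrow> 'a \<Rightarrow> nat \<Rightarrow> 'a vec" where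
  "pivot_vec A s j = (1 / conjugate s) \<cdot>\<^sub>v col A j"

lemma pivot_vec_carrier: "A \<in> carrier_mat n n \<Longrightarrow> pivot_vec A s j \<in> carrier_vec n"
  by (rule carrier_vecI) (simp add: pivot_vec_def)

lemma pivot_vec_index:
  assumes "A \<in> carrier_mat n n" "i < n" "j < n"
  shows "pivot_vec A s j $ i = A $$ (i, j) / conjugate s"
  using assms by (simp add: pivot_vec_def)

text \<open>
  The image of \<open>v v\<^sup>*\<close> consists of multiples of column \<open>j\<close> of \<open>A\<close>, so subtracting \<open>v v\<^sup>*\<close> has the effect of
  moving the argument of \<open>A\<close> along \<open>e\<^sub>j\<close>. Both the semidefiniteness of the
  remainder and the inclusion of its range in that of \<open>A\<close> rest on this.
\<close>
lemma mult_subtract_pivot: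
  assumes A: "A \<in> carrier_mat n n" and j: "j < n" and x: "x \<in> carrier_vec n"
  shows "\<exists>q. (A - outer_self (pivot_vec A s j)) *\<^sub>v x = A *\<^sub>v (x + q \<cdot>\<^sub>v unit_vec n j)"
proof -
  let ?v = "pivot_vec A s j"
  define t where "t = conjugate ?v \<bullet> x"
  define q where "q = - (t / conjugate s)"
  have v: "?v \<in> carrier_vec n" by (rule pivot_vec_carrier[OF A])
  have o: "(outer_self ?v *\<^sub>v x) $ i = ?v $ i * t" if "i < n" for i
    using that v x unfolding t_def
    by (simp add: outer_self_def scalar_prod_def sum_distrib_left mult.assoc)
  have "(A - outer_self ?v) *\<^sub>v x = A *\<^sub>v x + q \<cdot>\<^sub>v col A j"
  proof (rule eq_vecI)
    fix i assume "i < dim_vec (A *\<^sub>v x + q \<cdot>\<^sub>v col A j)"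
    then have i: "i < n" using A by simp
    have "((A - outer_self ?v) *\<^sub>v x) $ i = (A *\<^sub>v x) $ i - (outer_self ?v *\<^sub>v x) $ i"
      using A x i outer_self_carrier[OF v]
      by (simp add: minus_mult_distrib_mat_vec[where nr = n and nc = n] del: index_mult_mat_vec)
    then show "((A - outer_self ?v) *\<^sub>v x) $ i = (A *\<^sub>v x + q \<cdot>\<^sub>v col A j) $ i"
      using A i j by (simp add: o pivot_vec_index[OF A] q_def)
  qed (use A outer_self_carrier[OF v] in auto)
  also have "\<dots> = A *\<^sub>v (x + q \<cdot>\<^sub>v unit_vec n j)"
    using A x j by (simp add: mult_add_distrib_mat_vec[OF A] mult_mat_vec[OF A] mult_mat_vec_unit)
  finally show ?thesis by blast
qed

lemma subtract_pivot_index: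
  assumes A: "A \<in> psd_mats n" and i: "i < n" and l: "l < n" and j: "j < n"
  shows "(A - outer_self (pivot_vec A s j)) $$ (i, l)
    = A $$ (i, l) - A $$ (i, j) * A $$ (j, l) / (s * conjugate s)"
proof -
  have c: "A \<in> carrier_mat n n" using A by (simp add: psd_mats_def)
  have v: "pivot_vec A s j \<in> carrier_vec n" by (rule pivot_vec_carrier[OF c])
  show ?thesis using c i l j v
    by (simp add: outer_self_def pivot_vec_index[OF c] conjugate_divide psd_hermitian[OF A l j] mult.commute)
qed

lemma subtract_pivot_kills_row:
  assumes A: "A \<in> psd_mats n" and j: "j < n" and s: "s * conjugate s = A $$ (j, j)"
    and nz: "A $$ (j, j) \<noteq> 0" and x: "x \<in> carrier_vec n"
  shows "((A - outer_self (pivot_vec A s j)) *\<^sub>v x) $ j = 0"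
proof -
  let ?B = "A - outer_self (pivot_vec A s j)"
  have c: "A \<in> carrier_mat n n" using A by (simp add: psd_mats_def)
  have v: "pivot_vec A s j \<in> carrier_vec n" by (rule pivot_vec_carrier[OF c])
  have B: "?B \<in> carrier_mat n n" using outer_self_carrier[OF v] by (rule minus_carrier_mat)
  have z: "?B $$ (j, l) = 0" if "l < n" for l
    using subtract_pivot_index[OF A j that j, of s] s nz by simp
  have "row ?B j $ l = 0" if "l < n" for l
    by (subst index_row(1)) (use B j that z[OF that] in \<open>simp_all only: carrier_matD\<close>)
  then have "row ?B j = 0\<^sub>v n" using B by (intro eq_vecI) auto
  then have "row ?B j \<bullet> x = 0" using x by simp
  moreover have "(?B *\<^sub>v x) $ j = row ?B j \<bullet> x"
    using carrier_matD(1)[OF B] j by (intro index_mult_mat_vec) (simp only:)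
  ultimately show ?thesis by (rule trans[rotated])
qed

text \<open>
  Let \<open>B\<close> be the remainder and \<open>y = x + q e\<^sub>j\<close> with \<open>B x = A y\<close>. As \<open>B x\<close> vanishes at index \<open>j\<close>,
  its products with \<open>x\<close> and with \<open>y\<close> agree, so the form of \<open>B\<close> at \<open>x\<close> is the form of \<open>A\<close> at \<open>y\<close>.
\<close>
lemma psd_subtract_pivot:
  fixes A :: "'a :: conjugatable_ordered_field mat"
  assumes A: "A \<in> psd_mats n" and j: "j < n" and s: "s * conjugate s = A $$ (j, j)"
    and nz: "A $$ (j, j) \<noteq> 0"
  shows "A - outer_self (pivot_vec A s j) \<in> psd_mats n"
proof -
  let ?B = "A - outer_self (pivot_vec A s j)"
  have c: "A \<in> carrier_mat n n" using A by (simp add: psd_mats_def)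
  have v: "pivot_vec A s j \<in> carrier_vec n" by (rule pivot_vec_carrier[OF c])
  have B: "?B \<in> carrier_mat n n" using outer_self_carrier[OF v] by (rule minus_carrier_mat)
  have idx: "?B $$ (i, l) = A $$ (i, l) - A $$ (i, j) * A $$ (j, l) / A $$ (j, j)"
    if "i < n" "l < n" for i l
    using subtract_pivot_index[OF A that j] s by simp
  have herm: "mat_adjoint ?B = ?B"
  proof (rule eq_matI)
    fix i l assume "i < dim_row ?B" "l < dim_col ?B"
    then have i: "i < n" and l: "l < n" using B by auto
    have "mat_adjoint ?B $$ (i, l) = conjugate (?B $$ (l, i))"
      by (rule mat_adjoint_index[OF B i l])
    also have "\<dots> = ?B $$ (i, l)"
      unfolding idx[OF i l] idx[OF l i] psd_hermitian[OF A i l] psd_hermitian[OF A j l]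
        psd_hermitian[OF A i j]
      using psd_hermitian[OF A j j]
      by (simp add: conjugate_divide conjugate_dist_mul conjugate_dist_add conjugate_neg
          diff_conv_add_uminus mult.commute del: add_uminus_conv_diff)
    finally show "mat_adjoint ?B $$ (i, l) = ?B $$ (i, l)" .
  qed (use B in \<open>simp_all only: mat_adjoint_def mat_of_rows_carrier carrier_matD length_map cols_length\<close>)
  have "0 \<le> (?B *\<^sub>v x) \<bullet>c x" if x: "x \<in> carrier_vec n" for x
  proof -
    obtain q where q: "?B *\<^sub>v x = A *\<^sub>v (x + q \<cdot>\<^sub>v unit_vec n j)"
      using mult_subtract_pivot[OF c j x] by blast
    let ?y = "x + q \<cdot>\<^sub>v unit_vec n j"
    have y: "?y \<in> carrier_vec n" using x by simp
    have "(?B *\<^sub>v x) $ j = 0" by (rule subtract_pivot_kills_row[OF A j s nz x])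
    then have "(?B *\<^sub>v x) \<bullet>c x = (?B *\<^sub>v x) \<bullet>c ?y"
      using cscalar_prod_add_unit[OF mult_mat_vec_carrier[OF B x] x j] by simp
    also have "0 \<le> \<dots>" unfolding q using A y by (simp add: psd_mats_def)
    finally show ?thesis .
  qed
  then show ?thesis using B herm by (simp add: psd_mats_def)
qed

text \<open>
  The range shrinks strictly: column \<open>j\<close> of \<open>A\<close> has the pivot at index \<open>j\<close>, where every
  vector in the range of the remainder is zero.
\<close>
lemma rank_subtract_pivot:
  fixes A :: "'a :: conjugatable_ordered_field mat"
  assumes A: "A \<in> psd_mats n" and j: "j < n" and s: "s * conjugate s = A $$ (j, j)"
    and nz: "A $$ (j, j) \<noteq> 0"
  shows "vec_space.rank n (A - outer_self (pivot_vec A s j)) < vec_space.rank n A"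
proof -
  let ?B = "A - outer_self (pivot_vec A s j)"
  have c: "A \<in> carrier_mat n n" using A by (simp add: psd_mats_def)
  have v: "pivot_vec A s j \<in> carrier_vec n" by (rule pivot_vec_carrier[OF c])
  have B: "?B \<in> carrier_mat n n" using outer_self_carrier[OF v] by (rule minus_carrier_mat)
  have "A *\<^sub>v unit_vec n j \<noteq> ?B *\<^sub>v x" if x: "x \<in> carrier_vec n" for x
  proof -
    have "(?B *\<^sub>v x) $ j = 0" by (rule subtract_pivot_kills_row[OF A j s nz x])
    moreover have "(A *\<^sub>v unit_vec n j) $ j \<noteq> 0" using c j nz by simp
    ultimately show ?thesis by metis
  qed
  moreover have "\<exists>y \<in> carrier_vec n. ?B *\<^sub>v x = A *\<^sub>v y" if x: "x \<in> carrier_vec n" for x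
    using mult_subtract_pivot[OF c j x, of s] x by fastforce
  ultimately show ?thesis
    by (intro vec_space.rank_less_if_range_psubset[OF c B _ unit_vec_carrier])
qed

section \<open>Elimination in a banded matrix\<close>

text \<open>
  The index \<open>j\<close> counts the rows and columns that are already eliminated. It has to appear in the
  statement because the support of the next vector is bounded by the band on one side and by
  the eliminated rows on the other.
\<close>
lemma banded_psd_factor_decomp:
  fixes A :: "'a :: conjugatable_ordered_field mat"
  assumes sqrts: "\<And>a :: 'a. 0 \<le> a \<Longrightarrow> \<exists>s. s * conjugate s = a"
    and "A \<in> psd_mats n"
    and "\<And>i l. i < n \<Longrightarrow> l < n \<Longrightarrow> i < j \<or> l < j \<Longrightarrow> A $$ (i, l) = 0"
    and "\<And>i l. i < n \<Longrightarrow> l < n \<Longrightarrow> int k \<le> \<bar>int i - int l\<bar> \<Longrightarrow> A $$ (i, l) = 0"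
  shows "\<exists>vs. factor_decomp k A vs \<and> length vs \<le> vec_space.rank n A"
  using assms(2-)
proof (induction "n - j" arbitrary: j A)
  case 0
  have c: "A \<in> carrier_mat n n" using 0(2) by (simp add: psd_mats_def)
  have "A = 0\<^sub>m n n" using c 0 by (intro eq_matI) auto
  then have "factor_decomp k A []" by (simp add: factor_decomp_def)
  then show ?case by (intro exI[of _ "[]"]) simp
next
  case (Suc d)
  note A = Suc.prems(1) and zero = Suc.prems(2) and band = Suc.prems(3)
  have j: "j < n" and d: "d = n - Suc j" using Suc.hyps(2) by auto
  have c: "A \<in> carrier_mat n n" using A by (simp add: psd_mats_def)
  show ?case
  proof (cases "A $$ (j, j) = 0")
    case True
    have row: "A $$ (j, i) = 0" if "i < n" for i
      by (rule psd_zero_diagonal_imp_zero_row[OF A that j True])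
    have col: "A $$ (i, j) = 0" if "i < n" for i
      using psd_hermitian[OF A j that] row[OF that] by simp
    show ?thesis
      by (rule Suc.hyps(1)[OF d A]) (use zero row col band in \<open>auto simp: less_Suc_eq\<close>)
  next
    case nz: False
    obtain s where s: "s * conjugate s = A $$ (j, j)"
      using sqrts[OF psd_diagonal_nonneg[OF A j]] by blast
    let ?v = "pivot_vec A s j"
    let ?B = "A - outer_self ?v"
    have v: "?v \<in> carrier_vec n" by (rule pivot_vec_carrier[OF c])
    have idx: "?B $$ (i, l) = A $$ (i, l) - A $$ (i, j) * A $$ (j, l) / A $$ (j, j)"
      if "i < n" "l < n" for i l
      using subtract_pivot_index[OF A that j] s by simp
    have zeroB: "?B $$ (i, l) = 0" if il: "i < n" "l < n" "i < Suc j \<or> l < Suc j" for i l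
    proof -
      consider "i < j" | "l < j" | "i = j" | "l = j" using il(3) by linarith
      then show ?thesis
        by cases (use il j nz zero[of i l] zero[of i j] zero[of j l] in \<open>auto simp: idx\<close>)
    qed
    have bandB: "?B $$ (i, l) = 0" if il: "i < n" "l < n" "int k \<le> \<bar>int i - int l\<bar>" for i l
    proof (cases "i < j \<or> l < j")
      case True
      then show ?thesis using zeroB il by auto
    next
      case False
      \<comment> \<open>As \<open>j \<le> min i l\<close>, the larger of \<open>i\<close> and \<open>l\<close> is at least \<open>k\<close> away from \<open>j\<close>.\<close>
      then have "int k \<le> \<bar>int i - int j\<bar> \<or> int k \<le> \<bar>int j - int l\<bar>" using il(3) by linarith
      then have "A $$ (i, j) * A $$ (j, l) = 0" using band[of i j] band[of j l] il j by auto
      then show ?thesis using band[OF il] il by (simp add: idx)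
    qed
    obtain vs where vs: "factor_decomp k ?B vs" "length vs \<le> vec_space.rank n ?B"
      using Suc.hyps(1)[OF d psd_subtract_pivot[OF A j s nz] zeroB bandB] by blast
    have "{i. i < dim_vec ?v \<and> ?v $ i \<noteq> 0} \<subseteq> {j..<j + k}"
    proof
      fix i assume "i \<in> {i. i < dim_vec ?v \<and> ?v $ i \<noteq> 0}"
      then have i: "i < n" and "A $$ (i, j) \<noteq> 0" using v pivot_vec_index[OF c _ j] by auto
      then have "j \<le> i" "\<not> int k \<le> \<bar>int i - int j\<bar>"
        using zero[OF i j] band[OF i j] by force+
      then show "i \<in> {j..<j + k}" by auto
    qed
    then have supp: "card {i. i < dim_vec ?v \<and> ?v $ i \<noteq> 0} \<le> k"
      using card_mono[of "{j..<j + k}"] by simp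
    have o: "outer_self ?v \<in> carrier_mat n n" by (rule outer_self_carrier[OF v])
    have "A = outer_self ?v + ?B" using c o by (intro eq_matI) auto
    then have "factor_decomp k A (?v # vs)"
      using vs(1) supp v c o by (simp add: factor_decomp_def)
    moreover have "length (?v # vs) \<le> vec_space.rank n A"
      using vs(2) rank_subtract_pivot[OF A j s nz] by simp
    ultimately show ?thesis by blast
  qed
qed

text \<open>
  Any bound exceeding both dimensions is admissible in the definition, so the least one exists and
  has the defining property.
\<close>
lemma entry_eq_0_outside_bandwidth:
  assumes "bandwidth A \<le> k" and i: "i < dim_row A" and j: "j < dim_col A"
    and "int k \<le> \<bar>int i - int j\<bar>"
  shows "A $$ (i, j) = 0"
proof -
  let ?P = "\<lambda>b. 0 < b \<and>
     (\<forall>i < dim_row A. \<forall>j < dim_col A. int b \<le> \<bar>int i - int j\<bar> \<longrightarrow> A $$ (i, j) = 0)"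
  have "?P (Suc (dim_row A + dim_col A))" by auto
  then have "?P (bandwidth A)" unfolding bandwidth_def by (rule LeastI)
  then show ?thesis using assms by auto
qed

lemma fran_eq_rank:
  fixes A :: "'a :: conjugatable_ordered_field mat"
  assumes sqrts: "\<And>a :: 'a. 0 \<le> a \<Longrightarrow> \<exists>s. s * conjugate s = a"
    and A: "A \<in> psd_mats n" and band: "bandwidth A \<le> k"
  shows "factor_width_at_most k A \<and> fran k A = vec_space.rank n A"
proof -
  have c: "A \<in> carrier_mat n n" using A by (simp add: psd_mats_def)
  have lower: "vec_space.rank n A \<le> length vs" if "factor_decomp k A vs" for vs
    using that rank_sum_outer_self_le_length[of vs n] c by (auto simp: factor_decomp_def)
  obtain vs where vs: "factor_decomp k A vs" "length vs \<le> vec_space.rank n A"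
    using banded_psd_factor_decomp[OF sqrts A, of 0 k] entry_eq_0_outside_bandwidth[OF band] c
    by auto
  have "fran k A = vec_space.rank n A" unfolding fran_def
  proof (rule Least_equality)
    show "\<exists>vs. length vs = vec_space.rank n A \<and> factor_decomp k A vs"
      using vs lower[OF vs(1)] by (intro exI[of _ vs]) simp
  qed (use lower in blast)
  then show ?thesis using vs(1) by (auto simp: factor_width_at_most_def)
qed

theorem theorem3:
  fixes n k :: nat
  assumes "0 < k"
  shows "(\<forall>A :: real mat. A \<in> psd_mats n \<and> bandwidth A \<le> k \<longrightarrow>
            factor_width_at_most k A \<and> fran k A = vec_space.rank n A) \<and>
         (\<forall>A :: complex mat. A \<in> psd_mats n \<and> bandwidth A \<le> k \<longrightarrow>
            factor_width_at_most k A \<and> fran k A = vec_space.rank n A)"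
proof (rule conjI; intro allI impI; elim conjE)
  have real_sqrts: "\<exists>s. s * conjugate s = a" if "0 \<le> a" for a :: real
    using that by (intro exI[of _ "sqrt a"]) simp
  fix A :: "real mat" assume "A \<in> psd_mats n" "bandwidth A \<le> k"
  then show "factor_width_at_most k A \<and> fran k A = vec_space.rank n A"
    by (intro fran_eq_rank real_sqrts)
next
  have complex_sqrts: "\<exists>s. s * conjugate s = a" if "0 \<le> a" for a :: complex
    using that
    by (intro exI[of _ "complex_of_real (sqrt (Re a))"])
      (auto simp: less_eq_complex_def complex_eq_iff)
  fix A :: "complex mat" assume "A \<in> psd_mats n" "bandwidth A \<le> k"
  then show "factor_width_at_most k A \<and> fran k A = vec_space.rank n A"
    by (intro fran_eq_rank complex_sqrts)
qed

end
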